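(* Let $X\to\mathbb{P}^1$ be a Harbater–Katz–Gabber cover with Galois group a $p$-group over an algebraically closed field $\mathbf{k}$ of characteristic $p>0$, with notation as in the context. Let $$G_0=\{\omega_L\omega_K-\omega_{L'}\omega_{K'}\in\mathrm{Sym}\,H^0(X,\Omega_X):\ L+K=L'+K',\ L,K,L',K'\in\mathbf{A}\}.$$ Then $G_0$ is contained in the canonical ideal, i.e. in the kernel of the canonical map $\phi:\mathrm{Sym}\,H^0(X,\Omega_X)\to\bigoplus_{n\ge0}H^0(X,\Omega_X^{\otimes n})$.
   Context: $\mathbf{k}$ is an algebraically closed field of characteristic $p>0$; $\mathbb{N}$ contains $0$. A Harbater–Katz–Gabber (HKG) cover with $p$-group is a Galois cover $X\to\mathbb{P}^1$ of smooth projective curves over $\mathbf{k}$ with Galois group a $p$-group, having a unique ramified point $P\in X$, which is totally (and wildly) ramified. Let $g$ be the genus of $X$, $F$ its function field, and $G_j(P)$ the ramification groups at $P$ in lower numbering; $|G_0|$ denotes the order of the ramification group $G_0(P)=G_1(P)$ (the set $G_0$ in the claim is a different object with the same symbol). It is known that there is a tower $F_1=F^{G_1(P)}=\mathbf{k}(\bar f_0)\subset F_2\subset\cdots\subset F_{k+1}=F$ with $F_{i+1}=F_i(\bar f_i)$, $[F_{i+1}:F_i]=p^{n_i}$ for $1\le i\le k$, $|G_0|=p^{n_1+\cdots+n_k}$, such that, with $b_1<\dots<b_k$ the lower ramification jumps at $P$ (all prime to $p$), as functions on $X$: $\bar f_0$ has a pole only at $P$, of order $|G_0|$, and $\bar f_i$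 ($1\le i\le k$) has a pole only at $P$, of order $\bar m_i:=p^{n_{i+1}+\cdots+n_k}b_i$. The numbers $|G_0|,\bar m_1,\dots,\bar m_k$ generate the Weierstrass semigroup at $P$. For $\bar h=(i_0,\dots,i_k)\in\mathbb{N}^{k+1}$ put $\|\bar h\|=i_0|G_0|+\sum_{\nu=1}^k i_\nu\bar m_\nu$ and $f_{\bar h}=\bar f_0^{i_0}\cdots\bar f_k^{i_k}$. Let $\mathbf{A}=\{\bar h\in\mathbb{N}^{k+1}:\|\bar h\|\le 2g-2\}$. For $L\in\mathbf{A}$ let $\omega_L=f_L\,d\bar f_0$, which is a holomorphic differential on $X$. The canonical map $\phi$ is the natural multiplication map. *)

theory Defs
  imports
    "HOL-Algebra.Algebra"
    "HOL-Algebra.Algebraic_Closure_Type"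
    "HOL-Library.Poly_Mapping"
    "HOL-Computational_Algebra.Primes"
begin

section \<open>Function fields of curves and their points\<close>

text \<open>A smooth projective curve over \<open>K\<close> is given by its function field, which is the whole type
  \<open>'f\<close>; the constants are a subfield \<open>K\<close> of it.\<close>

abbreviation FF :: "'f::field ring" where
  "FF \<equiv> ring_of_type_algebra"

locale curve_function_field =
  fixes K :: "'f::field set" and p :: nat
  assumes constants_subfield: "subfield K FF"
    and constants_alg_closed: "algebraically_closed (FF\<lparr>carrier := K\<rparr>)"
    and char_p: "CHAR('f) = p" "p > 0"
    and one_variable: "\<exists>x. ring.transcendental FF K x \<and>
          ring.finite_dimension FF (generate_field FF (insert x K)) UNIV"

text \<open>The (closed) points of the curve, each represented by its local ring: the proper valuation
  rings of the function field that contain \<open>K\<close>.\<close>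

definition points :: "'f::field set \<Rightarrow> 'f set set" where
  "points K = {Q. subring Q FF \<and> K \<subseteq> Q \<and> Q \<noteq> UNIV \<and> (\<forall>x. x \<in> Q \<or> inverse x \<in> Q)}"

definition is_unit_of :: "'f::field set \<Rightarrow> 'f \<Rightarrow> bool" where
  "is_unit_of A x \<longleftrightarrow> x \<noteq> 0 \<and> x \<in> A \<and> inverse x \<in> A"

definition uniformizer :: "'f::field set \<Rightarrow> 'f \<Rightarrow> bool" where
  "uniformizer A t \<longleftrightarrow> t \<in> A \<and> t \<noteq> 0 \<and> {x \<in> A. \<not> is_unit_of A x} = {t * a |a. a \<in> A}"

text \<open>Order of vanishing; only meaningful for nonzero arguments.\<close>

definition ord_at :: "'f::field set \<Rightarrow> 'f \<Rightarrow> int" where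
  "ord_at Q x = (THE n. \<exists>t. uniformizer Q t \<and> is_unit_of Q (x / t powi n))"

definition pole_only_at :: "'f::field set \<Rightarrow> 'f set \<Rightarrow> 'f \<Rightarrow> nat \<Rightarrow> bool" where
  "pole_only_at K P x m \<longleftrightarrow>
     x \<noteq> 0 \<and> ord_at P x = - int m \<and> (\<forall>Q \<in> points K - {P}. x \<in> Q)"

definition weierstrass_semigroup :: "'f::field set \<Rightarrow> 'f set \<Rightarrow> nat set" where
  "weierstrass_semigroup K P = {m. \<exists>x. pole_only_at K P x m}"


section \<open>Galois covers and ramification\<close>

definition fixed_field :: "('f \<Rightarrow> 'f) set \<Rightarrow> 'f::field set" where
  "fixed_field G = {x. \<forall>\<sigma>\<in>G. \<sigma> x = x}"

text \<open>\<open>E \<inter> Q\<close> is the local ring of the point below \<open>Q\<close> on the curve with function field \<open>E\<close>.\<close>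

definition ramification_index :: "'f::field set \<Rightarrow> 'f set \<Rightarrow> nat" where
  "ramification_index E Q = (THE e. \<exists>t. uniformizer (E \<inter> Q) t \<and> ord_at Q t = int e)"

definition ramification_group :: "('f \<Rightarrow> 'f) set \<Rightarrow> 'f::field set \<Rightarrow> nat \<Rightarrow> ('f \<Rightarrow> 'f) set" where
  "ramification_group G P j =
     {\<sigma> \<in> G. \<sigma> ` P = P \<and> (\<forall>x\<in>P. \<sigma> x = x \<or> ord_at P (\<sigma> x - x) \<ge> int j + 1)}"

definition ramification_jumps :: "('f \<Rightarrow> 'f) set \<Rightarrow> 'f::field set \<Rightarrow> nat set" where
  "ramification_jumps G P =
     {j. ramification_group G P j \<noteq> ramification_group G P (Suc j)}"

text \<open>The cover corresponds to the extension of the function field over the fixed field of \<open>G\<close>; the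
  base is the projective line iff this fixed field is rational. Wildness of the
  ramification at \<open>P\<close> is implied: its index is greater than 1 and a power of \<open>p\<close>.\<close>

locale hkg_cover = curve_function_field K p
  for K :: "'f::field set" and p :: nat +
  fixes G :: "('f \<Rightarrow> 'f) set" and P :: "'f set"
  assumes galois_group: "subgroup G (BijGroup UNIV)" "finite G"
    and galois_automorphisms: "\<And>\<sigma>. \<sigma> \<in> G \<Longrightarrow> \<sigma> \<in> ring_iso FF FF"
      "\<And>\<sigma> c. \<sigma> \<in> G \<Longrightarrow> c \<in> K \<Longrightarrow> \<sigma> c = c"
    and p_group: "\<exists>s. card G = p ^ s"
    and base_rational: "\<exists>x. ring.transcendental FF K x \<and>
          fixed_field G = generate_field FF (insert x K)"
    and unique_ramified_point:
      "{Q \<in> points K. ramification_index (fixed_field G) Q > 1} = {P}"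
    and totally_ramified: "ramification_index (fixed_field G) P = card G"

definition pole_number :: "nat \<Rightarrow> nat \<Rightarrow> (nat \<Rightarrow> nat) \<Rightarrow> (nat \<Rightarrow> nat) \<Rightarrow> nat \<Rightarrow> nat" where
  "pole_number p r n b i = p ^ (\<Sum>\<nu> = Suc i..r. n \<nu>) * b i"

definition exponents :: "nat \<Rightarrow> (nat \<Rightarrow> nat) set" where
  "exponents r = {..r} \<rightarrow>\<^sub>E UNIV"

definition weight ::
  "('f \<Rightarrow> 'f) set \<Rightarrow> 'f::field set \<Rightarrow> nat \<Rightarrow> nat \<Rightarrow> (nat \<Rightarrow> nat) \<Rightarrow> (nat \<Rightarrow> nat) \<Rightarrow> (nat \<Rightarrow> nat) \<Rightarrow> nat"
where
  "weight G P p r n b h =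
     h 0 * card (ramification_group G P 0) + (\<Sum>\<nu> = 1..r. h \<nu> * pole_number p r n b \<nu>)"

text \<open>The tower \<open>F 1 \<subseteq> \<dots> \<subseteq> F (r + 1)\<close> with its generators \<open>f 0, \<dots>, f r\<close>; the index ranges
  of \<open>F\<close>, \<open>n\<close>, \<open>b\<close> start at 1.\<close>

locale hkg_tower = hkg_cover K p G P
  for K :: "'f::field set" and p :: nat and G :: "('f \<Rightarrow> 'f) set" and P :: "'f set" +
  fixes r :: nat and F :: "nat \<Rightarrow> 'f set" and f :: "nat \<Rightarrow> 'f"
    and n :: "nat \<Rightarrow> nat" and b :: "nat \<Rightarrow> nat"
  assumes tower_bottom: "F 1 = fixed_field (ramification_group G P 1)"
      "F 1 = generate_field FF (insert (f 0) K)"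
    and tower_step: "\<And>i. i \<in> {1..r} \<Longrightarrow> F (Suc i) = generate_field FF (insert (f i) (F i))"
    and tower_degree: "\<And>i. i \<in> {1..r} \<Longrightarrow> ring.dimension FF (p ^ n i) (F i) (F (Suc i))"
    and tower_top: "F (Suc r) = UNIV"
    and group_order: "card (ramification_group G P 0) = p ^ (\<Sum>i = 1..r. n i)"
    and jumps: "strict_mono_on {1..r} b" "b ` {1..r} = ramification_jumps G P"
      "\<And>i. i \<in> {1..r} \<Longrightarrow> coprime (b i) p"
    and pole_bottom: "pole_only_at K P (f 0) (card (ramification_group G P 0))"
    and pole_step: "\<And>i. i \<in> {1..r} \<Longrightarrow> pole_only_at K P (f i) (pole_number p r n b i)"
    and semigroup: "weierstrass_semigroup K P = weight G P p r n b ` exponents r"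


section \<open>Free, tensor and symmetric algebras\<close>

text \<open>Words form the free monoid, so that \<open>'v list \<Rightarrow>\<^sub>0 'a\<close> with its convolution product is the
  free associative algebra on \<open>'v\<close>.\<close>

instantiation list :: (type) monoid_add
begin

definition zero_list :: "'a list" where "zero_list = []"

definition plus_list :: "'a list \<Rightarrow> 'a list \<Rightarrow> 'a list" where "plus_list xs ys = xs @ ys"

instance
  by standard (simp_all add: zero_list_def plus_list_def)

end

definition scaled_word :: "'a::comm_ring_1 \<Rightarrow> 'v list \<Rightarrow> 'v list \<Rightarrow>\<^sub>0 'a" where
  "scaled_word c w = Poly_Mapping.single w c"

abbreviation var :: "'v \<Rightarrow> 'v list \<Rightarrow>\<^sub>0 'a::comm_ring_1" where
  "var v \<equiv> scaled_word 1 [v]"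

text \<open>Coefficients in the subring \<open>A\<close>, letters in \<open>V\<close>:\<close>

definition free_algebra :: "'a::comm_ring_1 set \<Rightarrow> 'v set \<Rightarrow> ('v list \<Rightarrow>\<^sub>0 'a) ring" where
  "free_algebra A V = ring_of_type_algebra
     \<lparr>carrier := {q. \<forall>w \<in> Poly_Mapping.keys q. w \<in> lists V \<and> Poly_Mapping.lookup q w \<in> A}\<rparr>"

text \<open>The symmetric algebra of the \<open>K\<close>-vector space \<open>V\<close> with operations \<open>vadd\<close> and \<open>scale\<close>.\<close>

definition sym_ideal ::
  "'a::comm_ring_1 set \<Rightarrow> ('v \<Rightarrow> 'v \<Rightarrow> 'v) \<Rightarrow> ('a \<Rightarrow> 'v \<Rightarrow> 'v) \<Rightarrow> 'v set \<Rightarrow> ('v list \<Rightarrow>\<^sub>0 'a) set"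
where
  "sym_ideal K vadd scale V = Idl\<^bsub>free_algebra K V\<^esub>
     ({var (vadd v w) - var v - var w |v w. v \<in> V \<and> w \<in> V} \<union>
      {var (scale c v) - scaled_word c [v] |c v. c \<in> K \<and> v \<in> V} \<union>
      {var v * var w - var w * var v |v w. v \<in> V \<and> w \<in> V})"

definition sym_algebra ::
  "'a::comm_ring_1 set \<Rightarrow> ('v \<Rightarrow> 'v \<Rightarrow> 'v) \<Rightarrow> ('a \<Rightarrow> 'v \<Rightarrow> 'v) \<Rightarrow> 'v set \<Rightarrow> ('v list \<Rightarrow>\<^sub>0 'a) set ring"
where
  "sym_algebra K vadd scale V = free_algebra K V Quot sym_ideal K vadd scale V"


section \<open>Differentials\<close>

text \<open>The letter \<open>x\<close> stands for the differential of the function \<open>x\<close>. The free algebra modulo the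
  defining relations of the Kaehler differentials is the tensor algebra, over the function field,
  of its module of Kaehler differentials over \<open>K\<close>; the words of length \<open>n\<close> span its \<open>n\<close>-th tensor
  power.\<close>

type_synonym 'f form = "('f list \<Rightarrow>\<^sub>0 'f) set"

definition kaehler_ideal :: "'f::field set \<Rightarrow> ('f list \<Rightarrow>\<^sub>0 'f) set" where
  "kaehler_ideal K = Idl\<^bsub>free_algebra UNIV UNIV\<^esub>
     ({var (x + y) - var x - var y |x y. True} \<union>
      {var (x * y) - scaled_word x [y] - scaled_word y [x] |x y. True} \<union>
      {var c |c. c \<in> K})"

definition form_ring :: "'f::field set \<Rightarrow> 'f form ring" where
  "form_ring K = free_algebra UNIV UNIV Quot kaehler_ideal K"

definition form_class :: "'f::field set \<Rightarrow> ('f list \<Rightarrow>\<^sub>0 'f) \<Rightarrow> 'f form" where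
  "form_class K q = kaehler_ideal K +>\<^bsub>free_algebra UNIV UNIV\<^esub> q"

text \<open>\<open>h dx\<close>, and multiplication by a function:\<close>

definition differential :: "'f::field set \<Rightarrow> 'f \<Rightarrow> 'f \<Rightarrow> 'f form" where
  "differential K h x = form_class K (scaled_word h [x])"

definition form_const :: "'f::field set \<Rightarrow> 'f \<Rightarrow> 'f form" where
  "form_const K c = form_class K (scaled_word c [])"

definition form_scale :: "'f::field set \<Rightarrow> 'f \<Rightarrow> 'f form \<Rightarrow> 'f form" where
  "form_scale K c \<omega> = form_const K c \<otimes>\<^bsub>form_ring K\<^esub> \<omega>"

text \<open>Image of the \<open>n\<close>-th tensor power over \<open>A\<close> of the differentials of \<open>A\<close> over \<open>K\<close>. For \<open>A = UNIV\<close>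
  these are the rational \<open>n\<close>-fold differentials; for the local ring \<open>A\<close> of a point, those that
  are regular there.\<close>

definition forms_over :: "'f::field set \<Rightarrow> nat \<Rightarrow> 'f set \<Rightarrow> 'f form set" where
  "forms_over K n A = form_class K ` {q. \<forall>w \<in> Poly_Mapping.keys q.
     length w = n \<and> w \<in> lists A \<and> Poly_Mapping.lookup q w \<in> A}"

text \<open>Global sections of the \<open>n\<close>-th tensor power of the canonical sheaf:\<close>

definition H0 :: "'f::field set \<Rightarrow> nat \<Rightarrow> 'f form set" where
  "H0 K n = {\<omega> \<in> forms_over K n UNIV. \<forall>Q \<in> points K. \<omega> \<in> forms_over K n Q}"

definition genus :: "'f::field set \<Rightarrow> nat" where
  "genus K = (THE g. ring.dimension (form_ring K) g (form_const K ` K) (H0 K 1))"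


section \<open>The canonical map\<close>

text \<open>The direct sum of the \<open>H0 K n\<close> is formed inside the graded ring \<open>form_ring K\<close>.\<close>

definition canonical_ring :: "'f::field set \<Rightarrow> 'f form ring" where
  "canonical_ring K = (form_ring K)
     \<lparr>carrier := {finsum (form_ring K) s {..N} |s N. \<forall>n. s n \<in> H0 K n}\<rparr>"

definition sym_differentials_ideal :: "'f::field set \<Rightarrow> ('f form list \<Rightarrow>\<^sub>0 'f) set" where
  "sym_differentials_ideal K =
     sym_ideal K (add (form_ring K)) (form_scale K) (H0 K 1)"

definition sym_differentials :: "'f::field set \<Rightarrow> ('f form list \<Rightarrow>\<^sub>0 'f) set ring" where
  "sym_differentials K = sym_algebra K (add (form_ring K)) (form_scale K) (H0 K 1)"

definition sym_var :: "'f::field set \<Rightarrow> 'f form \<Rightarrow> ('f form list \<Rightarrow>\<^sub>0 'f) set" where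
  "sym_var K \<omega> = sym_differentials_ideal K +>\<^bsub>free_algebra K (H0 K 1)\<^esub> var \<omega>"

definition multiply_out :: "'f::field set \<Rightarrow> ('f form list \<Rightarrow>\<^sub>0 'f) \<Rightarrow> 'f form" where
  "multiply_out K q = (\<Oplus>\<^bsub>form_ring K\<^esub> w \<in> Poly_Mapping.keys q.
     form_scale K (Poly_Mapping.lookup q w) (foldr (\<otimes>\<^bsub>form_ring K\<^esub>) w \<one>\<^bsub>form_ring K\<^esub>))"

text \<open>Tensor products of differentials on a curve commute, so \<open>multiply_out\<close> is constant on the
  cosets that make up \<open>sym_differentials K\<close>.\<close>

definition canonical_map :: "'f::field set \<Rightarrow> ('f form list \<Rightarrow>\<^sub>0 'f) set \<Rightarrow> 'f form" where
  "canonical_map K S = the_elem (multiply_out K ` S)"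

definition canonical_ideal :: "'f::field set \<Rightarrow> ('f form list \<Rightarrow>\<^sub>0 'f) set set" where
  "canonical_ideal K = a_kernel (sym_differentials K) (canonical_ring K) (canonical_map K)"


section \<open>The binomials\<close>

definition indices ::
  "'f::field set \<Rightarrow> ('f \<Rightarrow> 'f) set \<Rightarrow> 'f set \<Rightarrow> nat \<Rightarrow> nat \<Rightarrow> (nat \<Rightarrow> nat) \<Rightarrow> (nat \<Rightarrow> nat) \<Rightarrow> (nat \<Rightarrow> nat) set"
where
  "indices K G P p r n b =
     {h \<in> exponents r. int (weight G P p r n b h) \<le> 2 * int (genus K) - 2}"

definition omega :: "'f::field set \<Rightarrow> nat \<Rightarrow> (nat \<Rightarrow> 'f) \<Rightarrow> (nat \<Rightarrow> nat) \<Rightarrow> 'f form" where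
  "omega K r f L = differential K (\<Prod>i\<le>r. f i ^ L i) (f 0)"

definition binomials ::
  "'f::field set \<Rightarrow> nat \<Rightarrow> (nat \<Rightarrow> 'f) \<Rightarrow> (nat \<Rightarrow> nat) set \<Rightarrow> ('f form list \<Rightarrow>\<^sub>0 'f) set set"
where
  "binomials K r f A =
     {sym_var K (omega K r f L) \<otimes>\<^bsub>sym_differentials K\<^esub> sym_var K (omega K r f M)
        \<ominus>\<^bsub>sym_differentials K\<^esub>
      sym_var K (omega K r f L') \<otimes>\<^bsub>sym_differentials K\<^esub> sym_var K (omega K r f M')
      |L M L' M'. L \<in> A \<and> M \<in> A \<and> L' \<in> A \<and> M' \<in> A \<and> (\<forall>i\<le>r. L i + M i = L' i + M' i)}"

end

theory Submission
  imports Defs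
begin

text \<open>
  In the ring of differential forms the coefficients are central, so
  \<open>\<omega>\<^sub>L \<omega>\<^sub>M = (\<Prod>i. f\<^sub>i ^ (L\<^sub>i + M\<^sub>i)) df\<^sub>0 \<otimes> df\<^sub>0\<close> depends on \<open>L + M\<close> only
  (\<open>omega_mult\<close>), and a binomial of the theorem multiplies out to zero. The work lies in the
  canonical map: it is defined on cosets of the symmetric algebra by multiplying out a
  representative, and this must give the same result for all representatives.

  Multiplying out is a ring homomorphism from the free algebra on the holomorphic differentials to
  the forms (\<open>multiply_out_hom\<close>), and it clearly respects the linear relations of the symmetric
  algebra. It kills the commutators because any two differentials on a curve commute
  in the tensor algebra. Indeed all of them are multiples of a single \<open>dx\<close>
  (\<open>hkg_cover_differentials_rank_one\<close>, \<open>one_form_multiple\<close>), and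
  \<open>(h dx) \<otimes> (k dx) = h k dx \<otimes> dx\<close> is symmetric in \<open>h\<close> and \<open>k\<close>.

  The rank one property is where the cover enters. Its base is rational, with function field
  \<open>K(x)\<close>, and the rules of differentiation express \<open>dy\<close> by \<open>dx\<close> for all \<open>y \<in> K(x)\<close>
  (\<open>multiple_of_d_generate_field\<close>). A general function \<open>y\<close> is a simple root of the polynomial
  \<open>\<Prod>z. (T - z)\<close>, where \<open>z\<close> runs through the conjugates of \<open>y\<close> under the Galois group. Its
  coefficients are invariant and so lie in \<open>K(x)\<close>; differentiating the
  equation that \<open>y\<close> satisfies gives \<open>dy\<close> as a multiple of \<open>dx\<close> (\<open>multiple_of_d_separable\<close>).
\<close>

section \<open>The free algebra\<close>

lemma scaled_word_zero [simp]: "scaled_word 0 w = 0"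
  by (simp add: scaled_word_def)

lemma scaled_word_add: "scaled_word (a + b) w = scaled_word a w + scaled_word b w"
  by (simp add: scaled_word_def single_add)

lemma scaled_word_uminus: "scaled_word (- a) w = - scaled_word a w"
  by (simp add: scaled_word_def single_uminus)

lemma scaled_word_mult: "scaled_word a v * scaled_word b w = scaled_word (a * b) (v @ w)"
  by (simp add: scaled_word_def mult_single plus_list_def)

lemma scaled_word_one [simp]: "scaled_word 1 [] = 1"
  by (simp add: scaled_word_def flip: zero_list_def)

lemma lookup_scaled_word:
  "Poly_Mapping.lookup (scaled_word c w) v = (if v = w then c else 0)"
  by (simp add: scaled_word_def lookup_single when_def)

lemma keys_scaled_word: "Poly_Mapping.keys (scaled_word c w) = (if c = 0 then {} else {w})"
  by (simp add: scaled_word_def)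

lemma sum_scaled_words:
  "(\<Sum>w\<in>Poly_Mapping.keys q. scaled_word (Poly_Mapping.lookup q w) w) = q"
  by (rule poly_mapping_eqI)
    (simp add: lookup_sum lookup_scaled_word in_keys_iff)

lemma coefficient_central: "scaled_word c [] * q = q * scaled_word c []"
proof -
  have "scaled_word c [] * (\<Sum>w\<in>Poly_Mapping.keys q. scaled_word (Poly_Mapping.lookup q w) w) =
      (\<Sum>w\<in>Poly_Mapping.keys q. scaled_word (Poly_Mapping.lookup q w) w) * scaled_word c []"
    by (simp add: sum_distrib_left sum_distrib_right scaled_word_mult mult.commute)
  then show ?thesis by (simp add: sum_scaled_words)
qed

text \<open>The algebra homomorphism between free algebras that sends each letter \<open>v\<close> to \<open>\<rho> v\<close>. It lets
  \<open>multiply_out\<close>, a sum in a quotient ring, be computed on representatives.\<close>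

definition substitute ::
  "('v \<Rightarrow> 'w list \<Rightarrow>\<^sub>0 'a::comm_ring_1) \<Rightarrow> ('v list \<Rightarrow>\<^sub>0 'a) \<Rightarrow> 'w list \<Rightarrow>\<^sub>0 'a"
where
  "substitute \<rho> q = (\<Sum>w\<in>Poly_Mapping.keys q.
     scaled_word (Poly_Mapping.lookup q w) [] * prod_list (map \<rho> w))"

text \<open>A sum over a common superset of the supports makes additivity visible.\<close>

lemma substitute_superset:
  assumes "finite S" "Poly_Mapping.keys q \<subseteq> S"
  shows "substitute \<rho> q =
    (\<Sum>w\<in>S. scaled_word (Poly_Mapping.lookup q w) [] * prod_list (map \<rho> w))"
  unfolding substitute_def using assms
  by (intro sum.mono_neutral_left) (auto simp: in_keys_iff)

lemma substitute_zero [simp]: "substitute \<rho> 0 = 0"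
  by (simp add: substitute_def)

lemma substitute_scaled_word:
  "substitute \<rho> (scaled_word c w) = scaled_word c [] * prod_list (map \<rho> w)"
  by (simp add: substitute_def keys_scaled_word lookup_scaled_word)

lemma substitute_add: "substitute \<rho> (q + s) = substitute \<rho> q + substitute \<rho> s"
proof -
  let ?S = "Poly_Mapping.keys q \<union> Poly_Mapping.keys s"
  have "Poly_Mapping.keys (q + s) \<subseteq> ?S" by (rule keys_add)
  then show ?thesis
    by (simp add: substitute_superset[of ?S] lookup_add scaled_word_add distrib_right
        flip: sum.distrib)
qed

lemma substitute_sum: "substitute \<rho> (\<Sum>i\<in>S. q i) = (\<Sum>i\<in>S. substitute \<rho> (q i))"
  by (induction S rule: infinite_finite_induct) (simp_all add: substitute_add)

text \<open>Both sides are bilinear, so it suffices to compare them on words; there the point is that the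
  coefficient of the second word can be moved past the image of the first.\<close>

lemma substitute_mult:
  fixes \<rho> :: "'v \<Rightarrow> 'w list \<Rightarrow>\<^sub>0 'a::comm_ring_1"
  shows "substitute \<rho> (q * s) = substitute \<rho> q * substitute \<rho> s"
proof -
  have words: "substitute \<rho> (scaled_word a v * scaled_word b w) =
      substitute \<rho> (scaled_word a v) * substitute \<rho> (scaled_word b w)" for a b v w
  proof -
    have "scaled_word (a * b) [] * (x * y) =
        (scaled_word a [] * x) * (scaled_word b [] * y)" for x y :: "'w list \<Rightarrow>\<^sub>0 'a"
    proof -
      have "scaled_word (a * b) [] * (x * y) = scaled_word a [] * (scaled_word b [] * x) * y"
        using scaled_word_mult[of a "[]" b "[]"] by (metis append_Nil mult.assoc)
      also have "scaled_word b [] * x = x * scaled_word b []" by (rule coefficient_central)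
      finally show ?thesis by (simp add: mult.assoc)
    qed
    then show ?thesis by (simp add: scaled_word_mult substitute_scaled_word)
  qed
  let ?sum = "\<lambda>q. \<Sum>w\<in>Poly_Mapping.keys q. scaled_word (Poly_Mapping.lookup q w) w"
  have "substitute \<rho> (?sum q * ?sum s) = substitute \<rho> (?sum q) * substitute \<rho> (?sum s)"
    by (simp add: sum_product substitute_sum words)
  then show ?thesis by (simp add: sum_scaled_words)
qed

lemma ring_of_type_algebra_simps [simp]:
  "carrier (ring_of_type_algebra :: 'a::ring_1 ring) = UNIV"
  "\<zero>\<^bsub>ring_of_type_algebra :: 'a::ring_1 ring\<^esub> = 0"
  "\<one>\<^bsub>ring_of_type_algebra :: 'a::ring_1 ring\<^esub> = 1"
  "x \<oplus>\<^bsub>ring_of_type_algebra\<^esub> y = (x + y :: 'a::ring_1)"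
  "x \<otimes>\<^bsub>ring_of_type_algebra\<^esub> y = (x * y :: 'a::ring_1)"
  by (simp_all add: ring_of_type_algebra_def)

lemma ring_ring_of_type_algebra: "ring (ring_of_type_algebra :: 'a::ring_1 ring)"
proof -
  have "\<exists>y. x + y = 0" for x :: 'a
    using add.right_inverse by blast
  then show ?thesis
    by unfold_locales (auto simp: algebra_simps Units_def)
qed

lemma ring_of_type_algebra_uminus [simp]:
  "\<ominus>\<^bsub>ring_of_type_algebra\<^esub> x = (- x :: 'a::ring_1)"
proof -
  interpret ring "ring_of_type_algebra :: 'a ring" by (rule ring_ring_of_type_algebra)
  show ?thesis by (rule minus_equality) simp_all
qed

lemma FF_inv:
  fixes x :: "'a::field"
  assumes "x \<noteq> 0"
  shows "inv\<^bsub>FF\<^esub> x = inverse x"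
proof -
  interpret field "FF :: 'a ring" by (rule field_from_type_algebra)
  show ?thesis by (rule inv_char) (use assms in simp_all)
qed

lemma FF_subringD:
  assumes "subring A (FF :: 'a::field ring)"
  shows "0 \<in> A" "1 \<in> A" "a \<in> A \<Longrightarrow> - a \<in> A"
    "a \<in> A \<Longrightarrow> b \<in> A \<Longrightarrow> a + b \<in> A" "a \<in> A \<Longrightarrow> b \<in> A \<Longrightarrow> a * b \<in> A"
  using subringE(2,3,5,6,7)[OF assms] by simp_all

lemma free_algebra_simps [simp]:
  "\<zero>\<^bsub>free_algebra A V\<^esub> = 0"
  "\<one>\<^bsub>free_algebra A V\<^esub> = 1"
  "q \<oplus>\<^bsub>free_algebra A V\<^esub> s = q + s"
  "q \<otimes>\<^bsub>free_algebra A V\<^esub> s = q * s"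
  by (simp_all add: free_algebra_def)

lemma free_algebra_carrier: "carrier (free_algebra A V) =
    {q. \<forall>w\<in>Poly_Mapping.keys q. w \<in> lists V \<and> Poly_Mapping.lookup q w \<in> A}"
  by (simp add: free_algebra_def)

lemma free_algebra_UNIV [simp]: "carrier (free_algebra UNIV UNIV) = UNIV"
  by (simp add: free_algebra_carrier)

lemma scaled_word_in_free_algebra:
  "c \<in> A \<Longrightarrow> w \<in> lists V \<Longrightarrow> scaled_word c w \<in> carrier (free_algebra A V)"
  by (simp add: free_algebra_carrier keys_scaled_word lookup_scaled_word)

lemma ring_free_algebra:
  fixes A :: "'a::comm_ring_1 set"
  assumes A: "0 \<in> A" "1 \<in> A" "\<And>a. a \<in> A \<Longrightarrow> - a \<in> A"
    "\<And>a b. a \<in> A \<Longrightarrow> b \<in> A \<Longrightarrow> a + b \<in> A" "\<And>a b. a \<in> A \<Longrightarrow> b \<in> A \<Longrightarrow> a * b \<in> A"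
  shows "ring (free_algebra A V)"
proof -
  interpret T: ring "ring_of_type_algebra :: ('v list \<Rightarrow>\<^sub>0 'a) ring"
    by (rule ring_ring_of_type_algebra)
  let ?C = "carrier (free_algebra A V)"
  have lookup: "Poly_Mapping.lookup q w \<in> A" if "q \<in> ?C" for q w
  proof (cases "w \<in> Poly_Mapping.keys q")
    case True
    then show ?thesis using that unfolding free_algebra_carrier by blast
  next
    case False
    then show ?thesis using A(1) by (simp add: in_keys_iff)
  qed
  have zero: "0 \<in> ?C" by (simp add: free_algebra_carrier)
  have plus: "q + s \<in> ?C" if "q \<in> ?C" "s \<in> ?C" for q s
  proof -
    have "w \<in> lists V \<and> Poly_Mapping.lookup (q + s) w \<in> A"
      if "w \<in> Poly_Mapping.keys (q + s)" for w
    proof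
      have "w \<in> Poly_Mapping.keys q \<union> Poly_Mapping.keys s"
        using that keys_add[of q s] by (rule subsetD[rotated])
      then show "w \<in> lists V"
        using \<open>q \<in> ?C\<close> \<open>s \<in> ?C\<close> unfolding free_algebra_carrier by blast
      show "Poly_Mapping.lookup (q + s) w \<in> A"
        using lookup[OF \<open>q \<in> ?C\<close>] lookup[OF \<open>s \<in> ?C\<close>] A(4) by (simp add: lookup_add)
    qed
    then show ?thesis unfolding free_algebra_carrier by blast
  qed
  have sums: "(\<Sum>i\<in>S. q i) \<in> ?C" if "\<And>i. i \<in> S \<Longrightarrow> q i \<in> ?C" for S :: "'i set" and q
  proof (cases "finite S")
    case True
    then show ?thesis using that
      by (induction S rule: finite_induct) (use plus in \<open>simp_all add: zero\<close>)
  qed (simp add: zero)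
  have times: "q * s \<in> ?C" if "q \<in> ?C" "s \<in> ?C" for q s
  proof -
    have "(\<Sum>v\<in>Poly_Mapping.keys q. scaled_word (Poly_Mapping.lookup q v) v) *
        (\<Sum>w\<in>Poly_Mapping.keys s. scaled_word (Poly_Mapping.lookup s w) w) \<in> ?C"
      unfolding sum_distrib_right sum_distrib_left scaled_word_mult
      using that A(5)
      by (intro sums scaled_word_in_free_algebra) (simp_all add: free_algebra_carrier)
    then show ?thesis by (simp add: sum_scaled_words)
  qed
  have "subring ?C ring_of_type_algebra"
  proof (rule T.subringI)
    show "\<one>\<^bsub>ring_of_type_algebra\<^esub> \<in> ?C"
      using scaled_word_in_free_algebra[OF A(2), of "[]" V] by simp
    show "\<ominus>\<^bsub>ring_of_type_algebra\<^esub> q \<in> ?C" if "q \<in> ?C" for q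
      using that A(3) by (simp add: free_algebra_carrier)
  qed (simp_all add: plus times)
  from T.subring_is_ring[OF this] show ?thesis
    by (simp add: free_algebra_def)
qed

lemma free_algebra_minus:
  fixes A :: "'a::comm_ring_1 set"
  assumes "ring (free_algebra A V)" "q \<in> carrier (free_algebra A V)" "s \<in> carrier (free_algebra A V)"
    and "\<And>a. a \<in> A \<Longrightarrow> - a \<in> A"
  shows "q \<ominus>\<^bsub>free_algebra A V\<^esub> s = q - s"
proof -
  interpret ring "free_algebra A V" by fact
  have "- s \<in> carrier (free_algebra A V)"
    using assms(3,4) by (simp add: free_algebra_carrier)
  then have "\<ominus>\<^bsub>free_algebra A V\<^esub> s = - s"
    using assms(3) by (intro minus_equality) simp_all
  then show ?thesis by (simp add: a_minus_def)
qed

section \<open>The ring of differential forms\<close>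

lemma kaehler_ideal_ideal: "ideal (kaehler_ideal K) (free_algebra UNIV UNIV)"
proof -
  interpret ring "free_algebra (UNIV :: 'a::field set) (UNIV :: 'a set)"
    by (rule ring_free_algebra) simp_all
  show ?thesis unfolding kaehler_ideal_def by (rule genideal_ideal) simp
qed

lemma kaehler_ideal_zero: "0 \<in> kaehler_ideal K"
  and kaehler_ideal_add:
    "a \<in> kaehler_ideal K \<Longrightarrow> b \<in> kaehler_ideal K \<Longrightarrow> a + b \<in> kaehler_ideal K"
  and kaehler_ideal_lmult: "a \<in> kaehler_ideal K \<Longrightarrow> q * a \<in> kaehler_ideal K"
proof -
  interpret ideal "kaehler_ideal K" "free_algebra UNIV UNIV" by (rule kaehler_ideal_ideal)
  show "0 \<in> kaehler_ideal K" using additive_subgroup.zero_closed[OF is_additive_subgroup] by simp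
  show "a \<in> kaehler_ideal K \<Longrightarrow> b \<in> kaehler_ideal K \<Longrightarrow> a + b \<in> kaehler_ideal K"
    using additive_subgroup.a_closed[OF is_additive_subgroup] by simp
  show "a \<in> kaehler_ideal K \<Longrightarrow> q * a \<in> kaehler_ideal K"
    using I_l_closed[of a q] by simp
qed

lemma kaehler_ideal_diff:
  assumes "a \<in> kaehler_ideal K" "b \<in> kaehler_ideal K"
  shows "a - b \<in> kaehler_ideal K"
  using kaehler_ideal_add[OF assms(1) kaehler_ideal_lmult[OF assms(2), of "- 1"]] by simp

lemma kaehler_generators:
  shows d_add: "var (x + y) - var x - var y \<in> kaehler_ideal K"
    and d_mult: "var (x * y) - scaled_word x [y] - scaled_word y [x] \<in> kaehler_ideal K"
    and d_const: "c \<in> K \<Longrightarrow> var c \<in> kaehler_ideal K"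
proof -
  interpret ring "free_algebra (UNIV :: 'a::field set) (UNIV :: 'a set)"
    by (rule ring_free_algebra) simp_all
  note gen = genideal_self[unfolded free_algebra_UNIV, OF subset_UNIV, THEN subsetD]
  show "var (x + y) - var x - var y \<in> kaehler_ideal K"
    "var (x * y) - scaled_word x [y] - scaled_word y [x] \<in> kaehler_ideal K"
    "c \<in> K \<Longrightarrow> var c \<in> kaehler_ideal K"
    unfolding kaehler_ideal_def by (rule gen; blast)+
qed

lemma ring_form_ring: "ring (form_ring K)"
proof -
  interpret ideal "kaehler_ideal K" "free_algebra UNIV UNIV" by (rule kaehler_ideal_ideal)
  show ?thesis unfolding form_ring_def by (rule quotient_is_ring)
qed

lemma form_class_carrier: "form_class K a \<in> carrier (form_ring K)"
  and form_class_add: "form_class K a \<oplus>\<^bsub>form_ring K\<^esub> form_class K b = form_class K (a + b)"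
  and form_class_mult: "form_class K a \<otimes>\<^bsub>form_ring K\<^esub> form_class K b = form_class K (a * b)"
  and form_class_one: "\<one>\<^bsub>form_ring K\<^esub> = form_class K 1"
  and form_class_zero: "\<zero>\<^bsub>form_ring K\<^esub> = form_class K 0"
proof -
  interpret ideal "kaehler_ideal K" "free_algebra UNIV UNIV" by (rule kaehler_ideal_ideal)
  interpret h: ring_hom_ring "free_algebra UNIV UNIV" "form_ring K" "form_class K"
    using rcos_ring_hom_ring unfolding form_ring_def form_class_def[abs_def] .
  show "form_class K a \<in> carrier (form_ring K)"
    "form_class K a \<oplus>\<^bsub>form_ring K\<^esub> form_class K b = form_class K (a + b)"
    "form_class K a \<otimes>\<^bsub>form_ring K\<^esub> form_class K b = form_class K (a * b)"
    "\<one>\<^bsub>form_ring K\<^esub> = form_class K 1"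
    "\<zero>\<^bsub>form_ring K\<^esub> = form_class K 0"
    using h.hom_closed[of a] h.hom_add[of a b] h.hom_mult[of a b] h.hom_one h.hom_zero by simp_all
qed

lemma form_class_eq_iff: "form_class K a = form_class K b \<longleftrightarrow> a - b \<in> kaehler_ideal K"
proof -
  have "form_class K a = {i + a |i. i \<in> kaehler_ideal K}" for a
    by (auto simp: form_class_def a_r_coset_def')
  moreover have "{i + a |i. i \<in> kaehler_ideal K} = {i + b |i. i \<in> kaehler_ideal K}
      \<longleftrightarrow> a - b \<in> kaehler_ideal K"
  proof
    assume "{i + a |i. i \<in> kaehler_ideal K} = {i + b |i. i \<in> kaehler_ideal K}"
    moreover have "0 + a \<in> {i + a |i. i \<in> kaehler_ideal K}" using kaehler_ideal_zero by blast
    ultimately show "a - b \<in> kaehler_ideal K" by auto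
  next
    assume ab: "a - b \<in> kaehler_ideal K"
    have "i + a = (i + (a - b)) + b" "i + b = (i - (a - b)) + a" for i by simp_all
    then show "{i + a |i. i \<in> kaehler_ideal K} = {i + b |i. i \<in> kaehler_ideal K}"
      using kaehler_ideal_add[OF _ ab] kaehler_ideal_diff[OF _ ab] by blast
  qed
  ultimately show ?thesis by simp
qed

lemma form_carrierE:
  assumes "\<omega> \<in> carrier (form_ring K)"
  obtains a where "\<omega> = form_class K a"
  using assms by (auto simp: form_ring_def FactRing_def A_RCOSETS_def' form_class_def)

lemma form_class_sum:
  "finite S \<Longrightarrow> (\<Oplus>\<^bsub>form_ring K\<^esub>i\<in>S. form_class K (q i)) = form_class K (\<Sum>i\<in>S. q i)"
proof (induction S rule: finite_induct)
  interpret ring "form_ring K" by (rule ring_form_ring)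
  case empty
  show ?case by (simp add: form_class_zero)
next
  interpret ring "form_ring K" by (rule ring_form_ring)
  case (insert i S)
  then show ?case by (simp add: form_class_carrier form_class_add)
qed

lemma form_scale_class: "form_scale K c (form_class K a) = form_class K (scaled_word c [] * a)"
  by (simp add: form_scale_def form_const_def form_class_mult)

text \<open>Taking classes is a ring homomorphism, so it does not matter whether the letters of a word are
  multiplied as forms or through representatives \<open>\<rho> \<omega>\<close> of them.\<close>

lemma multiply_out_eq_substitute:
  assumes \<rho>: "\<And>\<omega>. \<omega> \<in> V \<Longrightarrow> form_class K (\<rho> \<omega>) = \<omega>"
    and q: "q \<in> carrier (free_algebra A V)"
  shows "multiply_out K q = form_class K (substitute \<rho> q)"
proof -
  have prod: "foldr (\<otimes>\<^bsub>form_ring K\<^esub>) w \<one>\<^bsub>form_ring K\<^esub> = form_class K (prod_list (map \<rho> w))"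
    if "w \<in> lists V" for w
    using that
  proof (induction w)
    case (Cons \<omega> w)
    then have "form_class K (\<rho> \<omega>) = \<omega>" by (intro \<rho>) simp
    then show ?case using Cons form_class_mult[of K "\<rho> \<omega>"] by simp
  qed (simp add: form_class_one)
  interpret ring "form_ring K" by (rule ring_form_ring)
  have "multiply_out K q = (\<Oplus>\<^bsub>form_ring K\<^esub>w\<in>Poly_Mapping.keys q.
      form_class K (scaled_word (Poly_Mapping.lookup q w) [] * prod_list (map \<rho> w)))"
    unfolding multiply_out_def
  proof (rule finsum_cong')
    show "form_scale K (Poly_Mapping.lookup q w) (foldr (\<otimes>\<^bsub>form_ring K\<^esub>) w \<one>\<^bsub>form_ring K\<^esub>) =
        form_class K (scaled_word (Poly_Mapping.lookup q w) [] * prod_list (map \<rho> w))"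
      if "w \<in> Poly_Mapping.keys q" for w
    proof -
      have "w \<in> lists V" using that q unfolding free_algebra_carrier by blast
      then show ?thesis by (simp add: prod form_scale_class)
    qed
  qed (simp_all add: form_class_carrier)
  then show ?thesis by (simp add: form_class_sum substitute_def)
qed

section \<open>The module of differentials has rank one\<close>

definition multiple_of_d :: "'f::field set \<Rightarrow> 'f \<Rightarrow> 'f \<Rightarrow> bool" where
  "multiple_of_d K x y \<longleftrightarrow> (\<exists>h. var y - scaled_word h [x] \<in> kaehler_ideal K)"

lemma kaehler_scale:
  "scaled_word b [y] - scaled_word h [x] \<in> kaehler_ideal K \<Longrightarrow>
   scaled_word (c * b) [y] - scaled_word (c * h) [x] \<in> kaehler_ideal K"
  using kaehler_ideal_lmult[of "scaled_word b [y] - scaled_word h [x]" K "scaled_word c []"]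
  by (simp add: right_diff_distrib scaled_word_mult)

lemma multiple_of_d_self: "multiple_of_d K x x"
  unfolding multiple_of_d_def using kaehler_ideal_zero by (intro exI[of _ 1]) simp

lemma multiple_of_d_const: "c \<in> K \<Longrightarrow> multiple_of_d K x c"
  unfolding multiple_of_d_def using d_const by (intro exI[of _ 0]) simp

lemma multiple_of_d_add:
  assumes "multiple_of_d K x y" "multiple_of_d K x z"
  shows "multiple_of_d K x (y + z)"
proof -
  obtain h k where h: "var y - scaled_word h [x] \<in> kaehler_ideal K"
    and k: "var z - scaled_word k [x] \<in> kaehler_ideal K"
    using assms unfolding multiple_of_d_def by blast
  have "var (y + z) - scaled_word (h + k) [x] \<in> kaehler_ideal K"
    using kaehler_ideal_add[OF kaehler_ideal_add[OF d_add[of y z K] h] k]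
    by (simp add: scaled_word_add algebra_simps)
  then show ?thesis unfolding multiple_of_d_def by blast
qed

lemma multiple_of_d_mult:
  assumes "multiple_of_d K x y" "multiple_of_d K x z"
  shows "multiple_of_d K x (y * z)"
proof -
  obtain h k where h: "var y - scaled_word h [x] \<in> kaehler_ideal K"
    and k: "var z - scaled_word k [x] \<in> kaehler_ideal K"
    using assms unfolding multiple_of_d_def by blast
  have "var (y * z) - scaled_word (y * k + z * h) [x] \<in> kaehler_ideal K"
    using kaehler_ideal_add[OF kaehler_ideal_add[OF d_mult[of y z K] kaehler_scale[OF h, of z]]
        kaehler_scale[OF k, of y]]
    by (simp add: scaled_word_add algebra_simps)
  then show ?thesis unfolding multiple_of_d_def by blast
qed

text \<open>From \<open>0 = d1 = d(y y\<inverse>) = y d(y\<inverse>) + y\<inverse> dy\<close>.\<close>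

lemma multiple_of_d_inverse:
  assumes "multiple_of_d K x y" "1 \<in> K" "y \<noteq> 0"
  shows "multiple_of_d K x (inverse y)"
proof -
  obtain h where h: "var y - scaled_word h [x] \<in> kaehler_ideal K"
    using assms(1) unfolding multiple_of_d_def by blast
  let ?z = "inverse y"
  have "var 1 - (var (y * ?z) - scaled_word y [?z] - scaled_word ?z [y]) \<in> kaehler_ideal K"
    by (rule kaehler_ideal_diff[OF d_const[OF assms(2)] d_mult])
  then have "scaled_word y [?z] - scaled_word (- ?z) [y] \<in> kaehler_ideal K"
    using assms(3) by (simp add: scaled_word_uminus algebra_simps)
  from kaehler_scale[OF this, of ?z]
  have "var ?z - scaled_word (- (?z * ?z)) [y] \<in> kaehler_ideal K"
    using assms(3) by simp
  from kaehler_ideal_add[OF this kaehler_scale[OF h, of "- (?z * ?z)"]]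
  have "var ?z - scaled_word (- (?z * ?z) * h) [x] \<in> kaehler_ideal K"
    by simp
  then show ?thesis unfolding multiple_of_d_def by blast
qed

lemma multiple_of_d_generate_field:
  assumes K: "subring K FF" and y: "y \<in> generate_field FF (insert x K)"
  shows "multiple_of_d K x y"
  using y
proof (induction y rule: generate_field.induct)
  case one
  then show ?case using FF_subringD(2)[OF K] by (simp add: multiple_of_d_const)
next
  case (incl h)
  then show ?case by (auto simp: multiple_of_d_const multiple_of_d_self)
next
  case (a_inv h)
  have "- 1 \<in> K" using FF_subringD(2,3)[OF K] by blast
  then show ?case using multiple_of_d_mult[OF multiple_of_d_const[of "- 1" K x] a_inv.IH] by simp
next
  case (m_inv h)
  then show ?case using FF_subringD(2)[OF K] by (simp add: FF_inv multiple_of_d_inverse)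
qed (simp_all add: multiple_of_d_add multiple_of_d_mult)

text \<open>The chain rule \<open>d(q(y)) = q'(y) dy + \<dots>\<close>, whose remaining terms come from the coefficients of
  \<open>q\<close> and are collected in \<open>h dx\<close>.\<close>

lemma d_poly:
  assumes K: "0 \<in> K" and q: "\<And>i. multiple_of_d K x (coeff q i)"
  shows "\<exists>h. var (poly q y) - scaled_word h [x] - scaled_word (poly (pderiv q) y) [y]
    \<in> kaehler_ideal K"
  using q
proof (induction q)
  case 0
  then show ?case using d_const[OF K] by (intro exI[of _ 0]) simp
next
  case (pCons a q)
  have "multiple_of_d K x (coeff q i)" for i using pCons.prems[of "Suc i"] by simp
  from pCons.IH[OF this] obtain h
    where h: "var (poly q y) - scaled_word h [x] - scaled_word (poly (pderiv q) y) [y]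
      \<in> kaehler_ideal K" by blast
  obtain k where k: "var a - scaled_word k [x] \<in> kaehler_ideal K"
    using pCons.prems[of 0] unfolding multiple_of_d_def by auto
  have "var (poly (pCons a q) y) - scaled_word (k + y * h) [x] -
      scaled_word (poly (pderiv (pCons a q)) y) [y] =
      (var (a + y * poly q y) - var a - var (y * poly q y)) + (var a - scaled_word k [x]) +
      (var (y * poly q y) - scaled_word y [poly q y] - scaled_word (poly q y) [y]) +
      scaled_word y [] *
        (var (poly q y) - scaled_word h [x] - scaled_word (poly (pderiv q) y) [y])"
    by (simp add: pderiv_pCons scaled_word_add scaled_word_mult algebra_simps)
  also have "\<dots> \<in> kaehler_ideal K"
    by (intro kaehler_ideal_add d_add k d_mult kaehler_ideal_lmult h)
  finally show ?case by blast
qed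

text \<open>By the chain rule \<open>0 = d(q(y)) = h dx + q'(y) dy\<close>, which can be solved for \<open>dy\<close> at a simple
  root.\<close>

lemma multiple_of_d_separable:
  assumes K: "0 \<in> K" and q: "\<And>i. multiple_of_d K x (coeff q i)"
    and root: "poly q y = 0" "poly (pderiv q) y \<noteq> 0"
  shows "multiple_of_d K x y"
proof -
  let ?c = "poly (pderiv q) y"
  obtain h where "var 0 - scaled_word h [x] - scaled_word ?c [y] \<in> kaehler_ideal K"
    using d_poly[OF K q, of y] root(1) by auto
  from kaehler_ideal_diff[OF d_const[OF K] this]
  have "scaled_word ?c [y] - scaled_word (- h) [x] \<in> kaehler_ideal K"
    by (simp add: scaled_word_uminus algebra_simps)
  from kaehler_scale[OF this, of "inverse ?c"] show ?thesis
    unfolding multiple_of_d_def using root(2) by auto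
qed

lemma hom_coeff_prod_linear:
  fixes \<sigma> :: "'a::comm_ring_1 \<Rightarrow> 'a"
  assumes "\<sigma> 0 = 0" "\<sigma> 1 = 1" "\<And>a b. \<sigma> (a + b) = \<sigma> a + \<sigma> b" "\<And>a b. \<sigma> (a * b) = \<sigma> a * \<sigma> b"
    and "finite S"
  shows "\<sigma> (coeff (\<Prod>z\<in>S. [:- z, 1:]) i) = coeff (\<Prod>z\<in>S. [:- \<sigma> z, 1:]) i"
  using \<open>finite S\<close>
proof (induction S arbitrary: i rule: finite_induct)
  case empty
  then show ?case by (simp add: assms(1,2) coeff_1)
next
  case (insert z S)
  have uminus: "\<sigma> (- a) = - \<sigma> a" for a
    using assms(3)[of "- a" a] assms(1) by (simp add: eq_neg_iff_add_eq_0)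
  then have "\<sigma> (a - b) = \<sigma> a - \<sigma> b" for a b using assms(3)[of a "- b"] by simp
  then show ?case using uminus
    using insert assms by (simp add: coeff_pCons split: nat.split)
qed

text \<open>The polynomial is the product of \<open>T - z\<close> over the set of conjugates \<open>z\<close> of \<open>y\<close>. Using the set
  of conjugates, without multiplicities, makes \<open>y\<close> a simple root; the group permutes
  this set, so the coefficients are invariant.\<close>

lemma separable_over_fixed_field:
  fixes y :: "'a::field"
  assumes G: "finite G" "id \<in> G" "\<And>\<sigma> \<tau>. \<sigma> \<in> G \<Longrightarrow> \<tau> \<in> G \<Longrightarrow> \<sigma> \<circ> \<tau> \<in> G"
    and aut: "\<And>\<sigma>. \<sigma> \<in> G \<Longrightarrow> \<sigma> \<in> ring_iso FF FF"
  obtains q where "\<And>i. coeff q i \<in> fixed_field G" "poly q y = 0" "poly (pderiv q) y \<noteq> 0"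
proof -
  define S where "S = (\<lambda>\<sigma>. \<sigma> y) ` G"
  define q where "q = (\<Prod>z\<in>S. [:- z, 1:])"
  have fin: "finite S" using G(1) by (simp add: S_def)
  have y: "y \<in> S" unfolding S_def using G(2) by (force intro: image_eqI[of _ _ id])
  have "\<sigma> (coeff q i) = coeff q i" if \<sigma>: "\<sigma> \<in> G" for \<sigma> i
  proof -
    have iso: "\<sigma> \<in> ring_hom FF FF" "bij \<sigma>"
      using aut[OF \<sigma>] by (simp_all add: ring_iso_def)
    have add: "\<sigma> (a + b) = \<sigma> a + \<sigma> b" for a b
      using ring_hom_add[OF iso(1), of a b] by simp
    have hom: "\<sigma> 1 = 1" "\<sigma> (a * b) = \<sigma> a * \<sigma> b" for a b
      using ring_hom_one[OF iso(1)] ring_hom_mult[OF iso(1), of a b] by simp_all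
    have zero: "\<sigma> 0 = 0" by (metis add add.right_neutral add_left_cancel)
    have inj: "inj_on \<sigma> S" using iso(2) by (meson bij_def inj_on_subset subset_UNIV)
    have "\<sigma> ` S \<subseteq> S" 
  proof
    fix z assume "z \<in> \<sigma> ` S"
    then obtain \<tau> where "\<tau> \<in> G" "z = (\<sigma> \<circ> \<tau>) y" by (auto simp: S_def)
    then show "z \<in> S"
      unfolding S_def using G(3)[OF \<sigma>] by (intro image_eqI[of _ _ "\<sigma> \<circ> \<tau>"])
  qed
    then have "\<sigma> ` S = S" by (rule endo_inj_surj[OF fin _ inj])
    then have "(\<Prod>z\<in>S. [:- \<sigma> z, 1:]) = q"
      unfolding q_def using prod.reindex[OF inj, of "\<lambda>z. [:- z, 1:]"] by simp
    then show ?thesis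
      using hom_coeff_prod_linear[of \<sigma> S i, OF zero hom(1) add hom(2) fin] by (simp add: q_def)
  qed
  then have "coeff q i \<in> fixed_field G" for i by (simp add: fixed_field_def)
  moreover have q_eq: "q = [:- y, 1:] * (\<Prod>z\<in>S - {y}. [:- z, 1:])"
    unfolding q_def by (rule prod.remove[OF fin y])
  then have "poly q y = 0" by simp
  moreover have "poly (pderiv q) y = (\<Prod>z\<in>S - {y}. y - z)"
    unfolding q_eq by (simp add: pderiv_mult pderiv_pCons poly_prod del: mult_pCons_left)
  then have "poly (pderiv q) y \<noteq> 0" using fin by simp
  ultimately show thesis by (rule that)
qed

text \<open>A generator \<open>x\<close> of the rational base will do, because the function field is separable over the
  fixed field \<open>K(x)\<close> of the Galois group.\<close>

lemma hkg_cover_differentials_rank_one: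
  assumes "hkg_cover K p G P"
  obtains x where "\<And>y. multiple_of_d K x y"
proof -
  interpret hkg_cover K p G P by fact
  obtain x where x: "fixed_field G = generate_field FF (insert x K)"
    using base_rational by blast
  have K: "subring K FF" using constants_subfield by (rule subfieldE)
  have Bij: "G \<subseteq> Bij UNIV"
    using subgroup.subset[OF galois_group(1)] by (simp add: BijGroup_def)
  have "id \<in> G"
    using subgroup.one_closed[OF galois_group(1)] by (simp add: BijGroup_def id_def restrict_UNIV)
  moreover have "\<sigma> \<circ> \<tau> \<in> G" if "\<sigma> \<in> G" "\<tau> \<in> G" for \<sigma> \<tau>
  proof -
    have "\<sigma> \<otimes>\<^bsub>BijGroup UNIV\<^esub> \<tau> = \<sigma> \<circ> \<tau>"
      using Bij that by (simp add: BijGroup_def compose_def comp_def restrict_UNIV subset_iff)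
    then show ?thesis using subgroup.m_closed[OF galois_group(1) that] by simp
  qed
  ultimately have "multiple_of_d K x y" for y
  proof (rule separable_over_fixed_field[OF galois_group(2)])
    show "\<sigma> \<in> ring_iso FF FF" if "\<sigma> \<in> G" for \<sigma>
      using that by (rule galois_automorphisms(1))
    fix q assume q: "\<And>i. coeff q i \<in> fixed_field G"
      and root: "poly q y = 0" "poly (pderiv q) y \<noteq> 0"
    have "multiple_of_d K x (coeff q i)" for i
      by (rule multiple_of_d_generate_field[OF K q[unfolded x]])
    then show "multiple_of_d K x y"
      by (rule multiple_of_d_separable[OF FF_subringD(1)[OF K] _ root])
  qed
  then show thesis by (rule that)
qed

text \<open>A differential is a sum of terms \<open>c dy\<close>, each of which is a multiple of \<open>dx\<close>.\<close>

lemma one_form_multiple: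
  assumes "\<And>y. multiple_of_d K x y" and "\<omega> \<in> forms_over K 1 UNIV"
  shows "\<exists>h. \<omega> = form_class K (scaled_word h [x])"
proof -
  obtain q where \<omega>: "\<omega> = form_class K q" and q: "\<forall>w\<in>Poly_Mapping.keys q. length w = 1"
    using assms(2) unfolding forms_over_def by blast
  obtain g where g: "var y - scaled_word (g y) [x] \<in> kaehler_ideal K" for y
    using assms(1) unfolding multiple_of_d_def by metis
  let ?h = "\<lambda>w. Poly_Mapping.lookup q w * g (hd w)"
  have word_class: "form_class K (scaled_word (Poly_Mapping.lookup q w) w) =
      form_class K (scaled_word (?h w) [x])" if "w \<in> Poly_Mapping.keys q" for w
  proof -
    have "length w = 1" using q that by blast
    then obtain y where y: "w = [y]" by (auto simp: length_Suc_conv)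
    show ?thesis
      using kaehler_scale[OF g[of y], of "Poly_Mapping.lookup q w"]
      by (simp only: y form_class_eq_iff mult_1_right list.sel)
  qed
  interpret ring "form_ring K" by (rule ring_form_ring)
  have "form_class K (\<Sum>w\<in>Poly_Mapping.keys q. scaled_word (Poly_Mapping.lookup q w) w) =
      form_class K (\<Sum>w\<in>Poly_Mapping.keys q. scaled_word (?h w) [x])"
    unfolding form_class_sum[OF finite_keys, symmetric]
    by (rule finsum_cong') (rule refl, simp add: form_class_carrier, erule word_class)
  moreover have "(\<Sum>w\<in>S. scaled_word (?h w) [x]) = scaled_word (\<Sum>w\<in>S. ?h w) [x]" for S
    by (induction S rule: infinite_finite_induct) (simp_all add: scaled_word_add)
  ultimately have "\<omega> = form_class K (scaled_word (\<Sum>w\<in>Poly_Mapping.keys q. ?h w) [x])"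
    unfolding \<omega> by (simp only: sum_scaled_words)
  then show ?thesis by blast
qed

section \<open>The canonical map\<close>

text \<open>Keeps \<open>H0 K 1\<close> in the form in which the algebraic structures below are interpreted.\<close>

declare One_nat_def [simp del]

text \<open>The next lemmas show that \<open>H0 K m\<close> is closed under the vector space operations. Without this the
  defining relations of the symmetric algebra could leave the free algebra on it.\<close>

lemma forms_over_add:
  assumes Q: "subring Q FF" and "\<omega> \<in> forms_over K m Q" "\<eta> \<in> forms_over K m Q"
  shows "\<omega> \<oplus>\<^bsub>form_ring K\<^esub> \<eta> \<in> forms_over K m Q"
proof -
  let ?D = "{q. \<forall>w\<in>Poly_Mapping.keys q.
    length w = m \<and> w \<in> lists Q \<and> Poly_Mapping.lookup q w \<in> Q}"
  obtain q s where q: "q \<in> ?D" "\<omega> = form_class K q" and s: "s \<in> ?D" "\<eta> = form_class K s"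
    using assms(2,3) unfolding forms_over_def by blast
  have "Poly_Mapping.lookup q w \<in> Q" "Poly_Mapping.lookup s w \<in> Q" for w
    using q(1) s(1) FF_subringD(1)[OF Q]
    by (auto simp: in_keys_iff)
  then have "Poly_Mapping.lookup (q + s) w \<in> Q" for w
    using FF_subringD(4)[OF Q] by (simp add: lookup_add)
  moreover have "Poly_Mapping.keys (q + s) \<subseteq> Poly_Mapping.keys q \<union> Poly_Mapping.keys s"
    by (rule keys_add)
  ultimately have "q + s \<in> ?D" using q(1) s(1) by blast
  then show ?thesis using q(2) s(2) by (auto simp: forms_over_def form_class_add)
qed

lemma forms_over_scale:
  assumes Q: "subring Q FF" and c: "c \<in> Q" and "\<omega> \<in> forms_over K m Q"
  shows "form_scale K c \<omega> \<in> forms_over K m Q"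
proof -
  let ?D = "{q. \<forall>w\<in>Poly_Mapping.keys q.
    length w = m \<and> w \<in> lists Q \<and> Poly_Mapping.lookup q w \<in> Q}"
  obtain q where q: "q \<in> ?D" "\<omega> = form_class K q"
    using assms(3) unfolding forms_over_def by blast
  have "scaled_word c [] * q = Poly_Mapping.map ((*) c) q"
  proof -
    have "scaled_word c [] * (\<Sum>w\<in>Poly_Mapping.keys q. scaled_word (Poly_Mapping.lookup q w) w) =
        Poly_Mapping.map ((*) c) q"
      by (rule poly_mapping_eqI) (simp add: sum_distrib_left scaled_word_mult lookup_sum
          lookup_scaled_word map.rep_eq when_def in_keys_iff)
    then show ?thesis by (simp add: sum_scaled_words)
  qed
  moreover have "Poly_Mapping.map ((*) c) q \<in> ?D"
    using q(1) c FF_subringD(5)[OF Q] by (auto simp: in_keys_iff map.rep_eq when_def)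
  ultimately show ?thesis using q(2) by (auto simp: forms_over_def form_scale_class)
qed

lemma H0_add:
  assumes "\<omega> \<in> H0 K m" "\<eta> \<in> H0 K m"
  shows "\<omega> \<oplus>\<^bsub>form_ring K\<^esub> \<eta> \<in> H0 K m"
proof -
  have "subring UNIV FF" using ring.carrier_is_subring[OF ring_ring_of_type_algebra] by simp
  then show ?thesis using assms by (auto simp: H0_def points_def intro: forms_over_add)
qed

lemma H0_scale:
  assumes "c \<in> K" "\<omega> \<in> H0 K m"
  shows "form_scale K c \<omega> \<in> H0 K m"
proof -
  have "subring UNIV FF" using ring.carrier_is_subring[OF ring_ring_of_type_algebra] by simp
  then show ?thesis using assms by (auto simp: H0_def points_def intro: forms_over_scale)
qed

lemma sym_ideal_ideal:
  assumes ring: "ring (free_algebra A V)" and A: "1 \<in> A" "\<And>a. a \<in> A \<Longrightarrow> - a \<in> A"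
    and V: "\<And>v w. v \<in> V \<Longrightarrow> w \<in> V \<Longrightarrow> vadd v w \<in> V" "\<And>c v. c \<in> A \<Longrightarrow> v \<in> V \<Longrightarrow> scale c v \<in> V"
  shows "ideal (sym_ideal A vadd scale V) (free_algebra A V)"
proof -
  interpret ring "free_algebra A V" by fact
  have var: "var v \<in> carrier (free_algebra A V)" if "v \<in> V" for v
    using that A(1) by (simp add: scaled_word_in_free_algebra)
  have word: "scaled_word c [v] \<in> carrier (free_algebra A V)" if "c \<in> A" "v \<in> V" for c v
    using that by (simp add: scaled_word_in_free_algebra)
  have diff: "q - s \<in> carrier (free_algebra A V)"
    if "q \<in> carrier (free_algebra A V)" "s \<in> carrier (free_algebra A V)" for q s
    using minus_closed[OF that] free_algebra_minus[OF ring that A(2)] by simp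
  have times: "q * s \<in> carrier (free_algebra A V)"
    if "q \<in> carrier (free_algebra A V)" "s \<in> carrier (free_algebra A V)" for q s
    using m_closed[OF that] by simp
  show ?thesis
    unfolding sym_ideal_def
    by (rule genideal_ideal) (auto intro!: diff times var word V)
qed

lemma sym_ideal_minimal:
  assumes ring: "ring (free_algebra A V)" and J: "ideal J (free_algebra A V)"
    and "\<And>v w. v \<in> V \<Longrightarrow> w \<in> V \<Longrightarrow> var (vadd v w) - var v - var w \<in> J"
    and "\<And>c v. c \<in> A \<Longrightarrow> v \<in> V \<Longrightarrow> var (scale c v) - scaled_word c [v] \<in> J"
    and "\<And>v w. v \<in> V \<Longrightarrow> w \<in> V \<Longrightarrow> var v * var w - var w * var v \<in> J"
  shows "sym_ideal A vadd scale V \<subseteq> J"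
  unfolding sym_ideal_def
  by (rule ring.genideal_minimal[OF ring J]) (use assms(3-5) in auto)

text \<open>The letters lift to representatives in the free algebra over the function field, which turns
  \<open>multiply_out\<close> into a substitution followed by the projection to forms.\<close>

lemma multiply_out_hom:
  fixes A :: "'f::field set"
  assumes ring: "ring (free_algebra A V)" and V: "V \<subseteq> carrier (form_ring K)"
  shows "ring_hom_ring (free_algebra A V) (form_ring K) (multiply_out K)"
proof -
  define \<rho> where "\<rho> = (\<lambda>\<omega>. SOME a. form_class K a = \<omega>)"
  have \<rho>: "form_class K (\<rho> \<omega>) = \<omega>" if \<omega>: "\<omega> \<in> V" for \<omega>
  proof -
    obtain a where "\<omega> = form_class K a" using V \<omega> form_carrierE by blast
    then show ?thesis unfolding \<rho>_def by (metis (mono_tags) someI_ex)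
  qed
  note eq = multiply_out_eq_substitute[OF \<rho>]
  interpret ring "free_algebra A V" by fact
  interpret R: ring "form_ring K" by (rule ring_form_ring)
  show ?thesis
  proof (rule ring_hom_ringI)
    show "ring (free_algebra A V)" "ring (form_ring K)" by unfold_locales
    fix q s assume q: "q \<in> carrier (free_algebra A V)"
    show "multiply_out K q \<in> carrier (form_ring K)"
      by (simp add: eq[OF _ q] form_class_carrier)
    assume s: "s \<in> carrier (free_algebra A V)"
    show "multiply_out K (q \<otimes>\<^bsub>free_algebra A V\<^esub> s) =
        multiply_out K q \<otimes>\<^bsub>form_ring K\<^esub> multiply_out K s"
      using eq[OF _ m_closed[OF q s]]
      by (simp add: eq[OF _ q] eq[OF _ s] substitute_mult form_class_mult)
    show "multiply_out K (q \<oplus>\<^bsub>free_algebra A V\<^esub> s) =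
        multiply_out K q \<oplus>\<^bsub>form_ring K\<^esub> multiply_out K s"
      using eq[OF _ a_closed[OF q s]]
      by (simp add: eq[OF _ q] eq[OF _ s] substitute_add form_class_add)
  next
    have "substitute \<rho> 1 = 1" using substitute_scaled_word[of \<rho> 1 "[]"] by simp
    then show "multiply_out K \<one>\<^bsub>free_algebra A V\<^esub> = \<one>\<^bsub>form_ring K\<^esub>"
      using eq[OF _ one_closed] by (simp add: form_class_one)
  qed
qed

lemma multiply_out_letter:
  assumes "\<omega> \<in> carrier (form_ring K)"
  shows "multiply_out K (scaled_word c [\<omega>]) = form_scale K c \<omega>"
proof -
  obtain a where a: "\<omega> = form_class K a" using assms by (rule form_carrierE)
  have "multiply_out K (scaled_word c [\<omega>]) =
      form_class K (substitute (\<lambda>_. a) (scaled_word c [\<omega>]))"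
    by (rule multiply_out_eq_substitute[of "{\<omega>}" _ _ _ UNIV])
      (simp_all add: a scaled_word_in_free_algebra)
  then show ?thesis by (simp add: substitute_scaled_word a form_scale_class)
qed

lemma multiply_out_var:
  assumes "\<omega> \<in> carrier (form_ring K)"
  shows "multiply_out K (var \<omega>) = \<omega>"
proof -
  obtain a where "\<omega> = form_class K a" using assms by (rule form_carrierE)
  then have "form_scale K 1 \<omega> = \<omega>" by (simp add: form_scale_class)
  then show ?thesis by (simp add: multiply_out_letter[OF assms])
qed

lemma H0_carrier: "H0 K m \<subseteq> carrier (form_ring K)"
  by (auto simp: H0_def forms_over_def form_class_carrier)

text \<open>The linear relations of the symmetric algebra hold in every module; the commutators are killed
  because all differentials are multiples of the same \<open>dx\<close>. This is what makes the canonical map well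
  defined.\<close>

lemma sym_differentials_ideal_multiply_out:
  assumes K: "subring K FF" and rank_one: "\<And>y. multiple_of_d K x y"
  shows "ideal (sym_differentials_ideal K) (free_algebra K (H0 K 1))"
    and "sym_differentials_ideal K \<subseteq>
      a_kernel (free_algebra K (H0 K 1)) (form_ring K) (multiply_out K)"
proof -
  let ?A = "free_algebra K (H0 K 1)"
  have ring: "ring ?A" using FF_subringD[OF K] by (intro ring_free_algebra) auto
  interpret ring_hom_ring ?A "form_ring K" "multiply_out K"
    by (rule multiply_out_hom[OF ring H0_carrier])
  have minus: "q \<ominus>\<^bsub>?A\<^esub> s = q - s" if "q \<in> carrier ?A" "s \<in> carrier ?A" for q s
    using ring that FF_subringD(3)[OF K] by (rule free_algebra_minus)
  show "ideal (sym_differentials_ideal K) ?A"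
    unfolding sym_differentials_ideal_def
    by (rule sym_ideal_ideal[OF ring]) (intro FF_subringD[OF K] H0_add H0_scale; assumption)+
  have kernel: "q - s \<in> a_kernel ?A (form_ring K) (multiply_out K)"
    if q: "q \<in> carrier ?A" and s: "s \<in> carrier ?A" and eq: "multiply_out K q = multiply_out K s"
    for q s
  proof -
    have "multiply_out K (q \<ominus>\<^bsub>?A\<^esub> s) =
        multiply_out K q \<oplus>\<^bsub>form_ring K\<^esub> \<ominus>\<^bsub>form_ring K\<^esub> multiply_out K s"
      unfolding a_minus_def by (simp only: hom_add[OF q R.a_inv_closed[OF s]] hom_a_inv[OF s])
    also have "\<dots> = \<zero>\<^bsub>form_ring K\<^esub>"
      unfolding eq by (rule S.r_neg[OF hom_closed[OF s]])
    finally show ?thesis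
      using R.minus_closed[OF q s] unfolding minus[OF q s] a_kernel_def' by blast
  qed
  have letter: "scaled_word c [\<omega>] \<in> carrier ?A" if "c \<in> K" "\<omega> \<in> H0 K 1" for c \<omega>
    using that by (simp add: scaled_word_in_free_algebra)
  have var: "var \<omega> \<in> carrier ?A" "multiply_out K (var \<omega>) = \<omega>" if "\<omega> \<in> H0 K 1" for \<omega>
    using that
    by (simp_all add: letter FF_subringD(2)[OF K] multiply_out_var H0_carrier[THEN subsetD])
  have commute: "\<omega> \<otimes>\<^bsub>form_ring K\<^esub> \<eta> = \<eta> \<otimes>\<^bsub>form_ring K\<^esub> \<omega>" if "\<omega> \<in> H0 K 1" "\<eta> \<in> H0 K 1" for \<omega> \<eta>
  proof -
    have "\<omega> \<in> forms_over K 1 UNIV" "\<eta> \<in> forms_over K 1 UNIV" using that by (simp_all add: H0_def)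
    then obtain h k where
      "\<omega> = form_class K (scaled_word h [x])" "\<eta> = form_class K (scaled_word k [x])"
      using one_form_multiple[OF rank_one, of \<omega>] one_form_multiple[OF rank_one, of \<eta>] by auto
    then show ?thesis by (simp add: form_class_mult scaled_word_mult mult.commute)
  qed
  show "sym_differentials_ideal K \<subseteq> a_kernel ?A (form_ring K) (multiply_out K)"
    unfolding sym_differentials_ideal_def
  proof (rule sym_ideal_minimal[OF ring])
    show "ideal (a_kernel ?A (form_ring K) (multiply_out K)) ?A" by (rule kernel_is_ideal)
  next
    fix v w assume v: "v \<in> H0 K 1" and w: "w \<in> H0 K 1"
    have "var (v \<oplus>\<^bsub>form_ring K\<^esub> w) - (var v + var w)
        \<in> a_kernel ?A (form_ring K) (multiply_out K)"
      using R.a_closed[OF var(1)[OF v] var(1)[OF w]] hom_add[OF var(1)[OF v] var(1)[OF w]]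
      by (intro kernel) (simp_all add: var v w H0_add)
    then show "var (v \<oplus>\<^bsub>form_ring K\<^esub> w) - var v - var w
        \<in> a_kernel ?A (form_ring K) (multiply_out K)"
      by (simp add: diff_diff_eq)
    show "var v * var w - var w * var v \<in> a_kernel ?A (form_ring K) (multiply_out K)"
      using R.m_closed[OF var(1)[OF v] var(1)[OF w]] hom_mult[OF var(1)[OF v] var(1)[OF w]]
        R.m_closed[OF var(1)[OF w] var(1)[OF v]] hom_mult[OF var(1)[OF w] var(1)[OF v]]
      by (intro kernel) (simp_all add: var v w commute)
  next
    fix c v assume c: "c \<in> K" and v: "v \<in> H0 K 1"
    then show "var (form_scale K c v) - scaled_word c [v]
        \<in> a_kernel ?A (form_ring K) (multiply_out K)"
      using FF_subringD(2)[OF K]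
      by (intro kernel) (simp_all add: var letter H0_scale multiply_out_letter H0_carrier[THEN subsetD])
  qed
qed

text \<open>\<open>the_elem\<close> returns the intended value since the homomorphism is constant on cosets of an ideal
  in its kernel.\<close>

lemma canonical_map_coset:
  assumes "ideal I R" and "ring_hom_ring R (form_ring K) (multiply_out K)"
    and "I \<subseteq> a_kernel R (form_ring K) (multiply_out K)" and "q \<in> carrier R"
  shows "canonical_map K (I +>\<^bsub>R\<^esub> q) = multiply_out K q"
proof -
  interpret ideal I R by fact
  interpret ring_hom_ring R "form_ring K" "multiply_out K" by fact
  have "multiply_out K (i \<oplus>\<^bsub>R\<^esub> q) = multiply_out K q" if i: "i \<in> I" for i
  proof -
    have "multiply_out K i = \<zero>\<^bsub>form_ring K\<^esub>"
      using subsetD[OF assms(3) i] unfolding a_kernel_def' by simp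
    then show ?thesis using hom_add[OF a_Hcarr[OF i] assms(4)] hom_closed[OF assms(4)] by simp
  qed
  then have "(\<lambda>i. multiply_out K (i \<oplus>\<^bsub>R\<^esub> q)) ` I = (\<lambda>i. multiply_out K q) ` I"
    by (rule image_cong[OF refl])
  also have "\<dots> = {multiply_out K q}"
    by (rule image_constant[OF additive_subgroup.zero_closed[OF is_additive_subgroup]])
  finally have "(\<lambda>i. multiply_out K (i \<oplus>\<^bsub>R\<^esub> q)) ` I = {multiply_out K q}" .
  moreover have "I +>\<^bsub>R\<^esub> q = (\<lambda>i. i \<oplus>\<^bsub>R\<^esub> q) ` I"
    unfolding a_r_coset_def' by blast
  ultimately have "multiply_out K ` (I +>\<^bsub>R\<^esub> q) = {multiply_out K q}"
    by (simp only: image_image)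
  then show ?thesis by (simp add: canonical_map_def)
qed

lemma binomial_in_canonical_ideal:
  assumes K: "subring K FF" and rank_one: "\<And>y. multiple_of_d K x y"
    and H0: "\<alpha> \<in> H0 K 1" "\<beta> \<in> H0 K 1" "\<gamma> \<in> H0 K 1" "\<delta> \<in> H0 K 1"
    and eq: "\<alpha> \<otimes>\<^bsub>form_ring K\<^esub> \<beta> = \<gamma> \<otimes>\<^bsub>form_ring K\<^esub> \<delta>"
  shows "sym_var K \<alpha> \<otimes>\<^bsub>sym_differentials K\<^esub> sym_var K \<beta>
    \<ominus>\<^bsub>sym_differentials K\<^esub> sym_var K \<gamma> \<otimes>\<^bsub>sym_differentials K\<^esub> sym_var K \<delta>
    \<in> canonical_ideal K"
proof -
  let ?A = "free_algebra K (H0 K 1)" and ?I = "sym_differentials_ideal K"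
  have ring: "ring ?A" using FF_subringD[OF K] by (intro ring_free_algebra) auto
  interpret I: ideal ?I ?A by (rule sym_differentials_ideal_multiply_out(1)[OF K rank_one])
  have Quot: "sym_differentials K = ?A Quot ?I"
    by (simp add: sym_differentials_def sym_algebra_def sym_differentials_ideal_def)
  interpret Q: ring_hom_ring ?A "sym_differentials K" "\<lambda>q. ?I +>\<^bsub>?A\<^esub> q"
    using I.rcos_ring_hom_ring unfolding Quot .
  interpret M: ring_hom_ring ?A "form_ring K" "multiply_out K"
    by (rule multiply_out_hom[OF ring H0_carrier])
  have var: "var \<omega> \<in> carrier ?A" "multiply_out K (var \<omega>) = \<omega>" if "\<omega> \<in> H0 K 1" for \<omega>
    using that by (simp_all add: scaled_word_in_free_algebra FF_subringD(2)[OF K]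
        multiply_out_var H0_carrier[THEN subsetD])
  let ?q = "var \<alpha> \<otimes>\<^bsub>?A\<^esub> var \<beta> \<ominus>\<^bsub>?A\<^esub> var \<gamma> \<otimes>\<^bsub>?A\<^esub> var \<delta>"
  have q: "?q \<in> carrier ?A"
    by (intro I.minus_closed I.m_closed var H0)
  note var_mult = I.m_closed[OF var(1) var(1)]
  have "multiply_out K ?q = \<alpha> \<otimes>\<^bsub>form_ring K\<^esub> \<beta> \<ominus>\<^bsub>form_ring K\<^esub> \<gamma> \<otimes>\<^bsub>form_ring K\<^esub> \<delta>"
    unfolding a_minus_def
    by (simp only: M.hom_add M.hom_a_inv M.hom_mult I.a_inv_closed var_mult var H0)
  also have "\<dots> = \<zero>\<^bsub>form_ring K\<^esub>"
    unfolding eq a_minus_def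
    by (intro M.S.r_neg M.S.m_closed subsetD[OF H0_carrier[of K 1]] H0)
  finally have "multiply_out K ?q = \<zero>\<^bsub>form_ring K\<^esub>" .
  moreover have zero: "\<zero>\<^bsub>canonical_ring K\<^esub> = \<zero>\<^bsub>form_ring K\<^esub>"
    by (simp add: canonical_ring_def)
  ultimately have "canonical_map K (?I +>\<^bsub>?A\<^esub> ?q) = \<zero>\<^bsub>canonical_ring K\<^esub>"
    using canonical_map_coset[OF I.ideal_axioms M.ring_hom_ring_axioms
        sym_differentials_ideal_multiply_out(2)[OF K rank_one] q]
    by (simp only: zero)
  moreover have "?I +>\<^bsub>?A\<^esub> ?q = sym_var K \<alpha> \<otimes>\<^bsub>sym_differentials K\<^esub> sym_var K \<beta>
      \<ominus>\<^bsub>sym_differentials K\<^esub> sym_var K \<gamma> \<otimes>\<^bsub>sym_differentials K\<^esub> sym_var K \<delta>"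
    unfolding sym_var_def a_minus_def
    by (simp only: Q.hom_add Q.hom_a_inv Q.hom_mult I.a_inv_closed var_mult var(1) H0)
  moreover have "?I +>\<^bsub>?A\<^esub> ?q \<in> carrier (sym_differentials K)"
    by (rule Q.hom_closed[OF q])
  ultimately show ?thesis
    unfolding canonical_ideal_def a_kernel_def' by simp
qed

lemma omega_mult:
  "omega K r f L \<otimes>\<^bsub>form_ring K\<^esub> omega K r f M =
    form_class K (scaled_word (\<Prod>i\<le>r. f i ^ (L i + M i)) [f 0, f 0])"
  by (simp add: omega_def differential_def form_class_mult scaled_word_mult power_add
      flip: prod.distrib)

theorem proposition7:
  fixes K :: "'f::field set" and p :: nat and G :: "('f \<Rightarrow> 'f) set" and P :: "'f set"
    and r :: nat and F :: "nat \<Rightarrow> 'f set" and f :: "nat \<Rightarrow> 'f"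
    and n :: "nat \<Rightarrow> nat" and b :: "nat \<Rightarrow> nat"
  assumes "hkg_tower K p G P r F f n b"
    and "\<And>L. L \<in> indices K G P p r n b \<Longrightarrow> omega K r f L \<in> H0 K 1"
  shows "binomials K r f (indices K G P p r n b) \<subseteq> canonical_ideal K"
proof -
  interpret hkg_tower K p G P r F f n b by (fact assms(1))
  have K: "subring K FF" using constants_subfield by (rule subfieldE)
  obtain x where x: "\<And>y. multiple_of_d K x y"
    using hkg_cover_differentials_rank_one[OF hkg_cover_axioms] by blast
  show ?thesis
  proof
    fix S assume "S \<in> binomials K r f (indices K G P p r n b)"
    then obtain L M L' M' where S: "S =
        sym_var K (omega K r f L) \<otimes>\<^bsub>sym_differentials K\<^esub> sym_var K (omega K r f M)
        \<ominus>\<^bsub>sym_differentials K\<^esub>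
        sym_var K (omega K r f L') \<otimes>\<^bsub>sym_differentials K\<^esub> sym_var K (omega K r f M')"
      and ind: "L \<in> indices K G P p r n b" "M \<in> indices K G P p r n b"
        "L' \<in> indices K G P p r n b" "M' \<in> indices K G P p r n b"
      and exponents: "\<forall>i\<le>r. L i + M i = L' i + M' i"
      unfolding binomials_def by blast
    have "(\<Prod>i\<le>r. f i ^ (L i + M i)) = (\<Prod>i\<le>r. f i ^ (L' i + M' i))"
      using exponents by (intro prod.cong) simp_all
    then show "S \<in> canonical_ideal K"
      unfolding S by (intro binomial_in_canonical_ideal[OF K x] assms(2) ind) (simp add: omega_mult)
  qed
qed

end
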